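(* Let $G$ be a finite group of order $p^2q$, where $p$ and $q$ are distinct primes and $p<q$. Then $|c(G)|$ is equal to one of $6$, $2p+4$, $pq+4$, $q+4$, or $2q+2$.
   Context: For a finite group $G$, $c(G)$ denotes the set of all cyclic subgroups of $G$ (including the trivial subgroup), so $|c(G)|$ is the number of cyclic subgroups of $G$. *)

theory Defs
  imports "HOL-Algebra.Algebra"
begin

definition cyclic_subgroups :: "('a, 'b) monoid_scheme \<Rightarrow> 'a set set" where
  "cyclic_subgroups G = {H. subgroup H G \<and> cyclic_group (G\<lparr>carrier := H\<rparr>)}"

end

theory Submission
  imports Defs "HOL-Number_Theory.Residues"
begin

text \<open>
  A cyclic subgroup of order \<open>n\<close> has \<open>totient n\<close> generators, so \<open>|c(G)|\<close> is the sum over all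
  \<open>x \<in> G\<close> of \<open>1 / totient (ord x)\<close>; write \<open>w(A)\<close> for this sum over a subset \<open>A\<close>. Let \<open>P\<close>, \<open>Q\<close> be
  Sylow subgroups of order \<open>p\<^sup>2\<close>, \<open>q\<close>. Then \<open>w(Q) = 2\<close>, and \<open>w(P)\<close> is \<open>3\<close> or \<open>p + 2\<close>.

  If \<open>Q\<close> is normal, let \<open>K\<close> be the centralizer of \<open>Q\<close> in \<open>P\<close>. For \<open>u \<in> Q\<close>, \<open>h \<in> P\<close> the order of \<open>u h\<close> is
  \<open>ord u * ord h\<close> if \<open>h \<in> K\<close> and \<open>ord h\<close> otherwise, so \<open>w(G) = 2 w(K) + q (w(P) - w(K))\<close>. The case of
  trivial \<open>K\<close> and noncyclic \<open>P\<close> does not occur, since \<open>x\<^sup>p = 1\<close> has at most \<open>p\<close> solutions modulo \<open>q\<close>.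

  If \<open>Q\<close> is not normal, Sylow's theorem forces \<open>p = 2\<close>, \<open>q = 3\<close> and four conjugates of \<open>Q\<close>, whose
  eight elements of order \<open>3\<close> form the complement of \<open>P\<close>; hence \<open>w(G) = w(P) + 4\<close>.
\<close>

section \<open>Counting cyclic subgroups by weighing elements\<close>

definition cyclic_weight :: "('a, 'b) monoid_scheme \<Rightarrow> 'a set \<Rightarrow> real" where
  "cyclic_weight G A = (\<Sum>x\<in>A. 1 / real (totient (group.ord G x)))"

context group
begin

text \<open>Powers computed in a subgroup agree with powers in \<open>G\<close>, so the intrinsic
  predicate \<open>cyclic_group\<close> on a subgroup can be replaced by generation inside
  \<open>G\<close>.\<close>

lemma cyclic_subgroups_eq_image_generate:
  "cyclic_subgroups G = (\<lambda>x. generate G {x}) ` carrier G"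
proof -
  have *: "cyclic_group (G\<lparr>carrier := H\<rparr>) \<longleftrightarrow> (\<exists>x\<in>H. H = generate G {x})" if H: "subgroup H G" for H
  proof -
    interpret H: group "G\<lparr>carrier := H\<rparr>"
      using H by (rule subgroup_imp_group)
    have "range (\<lambda>n::int. x [^]\<^bsub>G\<lparr>carrier := H\<rparr>\<^esub> n) = generate G {x}" if "x \<in> H" for x
    proof -
      have "x \<in> carrier G" by (rule subgroup.mem_carrier[OF H that])
      then show ?thesis
        using int_pow_consistent[OF H that] by (auto simp: generate_pow)
    qed
    then show ?thesis
      by (auto simp: H.cyclic_group)
  qed
  show ?thesis
  proof (intro Set.set_eqI iffI)
    fix H assume "H \<in> cyclic_subgroups G"
    then have H: "subgroup H G" and "cyclic_group (G\<lparr>carrier := H\<rparr>)"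
      by (auto simp: cyclic_subgroups_def)
    then obtain x where "x \<in> H" "H = generate G {x}"
      using *[OF H] by blast
    with H show "H \<in> (\<lambda>x. generate G {x}) ` carrier G"
      using subgroup.mem_carrier[OF H \<open>x \<in> H\<close>] by (intro image_eqI[of _ _ x])
  next
    fix H assume "H \<in> (\<lambda>x. generate G {x}) ` carrier G"
    then obtain x where x: "x \<in> carrier G" "H = generate G {x}" by auto
    then have H: "subgroup H G" and "x \<in> H"
      using generate_is_subgroup[of "{x}"] generate.incl[of x "{x}" G] by auto
    then have "cyclic_group (G\<lparr>carrier := H\<rparr>)"
      using *[OF H] x(2) by blast
    with H show "H \<in> cyclic_subgroups G"
      by (simp add: cyclic_subgroups_def)
  qed
qed

text \<open>\<open>ord x\<close> is the size of \<open>generate G {x}\<close>, and in a finite group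
  an inclusion between sets of equal size is an equality. This describes the fibres of the map from
  elements to the subgroups they generate.\<close>

lemma generate_singleton_eq_iff:
  assumes "finite (carrier G)" "g \<in> carrier G" "x \<in> carrier G"
  shows "generate G {x} = generate G {g} \<longleftrightarrow> x \<in> generate G {g} \<and> ord x = ord g"
proof
  assume "generate G {x} = generate G {g}"
  then show "x \<in> generate G {g} \<and> ord x = ord g"
    using generate_pow_card[OF assms(2)] generate_pow_card[OF assms(3)] generate.incl[of x "{x}" G]
    by simp
next
  assume x: "x \<in> generate G {g} \<and> ord x = ord g"
  have sub: "subgroup (generate G {g}) G"
    using assms by (intro generate_is_subgroup) auto
  have "generate G {x} \<subseteq> generate G {g}"
    using generate_subgroup_incl[OF _ sub] x by auto
  moreover have "finite (generate G {g})"
    using assms sub finite_subset subgroup.subset by blast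
  ultimately show "generate G {x} = generate G {g}"
    using x generate_pow_card[OF assms(2)] generate_pow_card[OF assms(3)]
    by (intro card_subset_eq) simp_all
qed

text \<open>The power \<open>g [^] k\<close> has the same order as \<open>g\<close> exactly when
  \<open>k\<close> is coprime to \<open>ord g\<close>, so generators correspond to
  totatives.\<close>

lemma card_generators:
  assumes fin: "finite (carrier G)" and g: "g \<in> carrier G"
  shows "card {x \<in> generate G {g}. ord x = ord g} = totient (ord g)"
proof -
  have pos: "ord g > 0" using ord_ge_1[OF assms] by simp
  \<comment> \<open>Exponents run from 1 to \<open>ord g\<close> instead of from 0 to
    \<open>ord g - 1\<close> to match the range of \<open>totatives\<close>; the identity is now the
    power with exponent \<open>ord g\<close>.\<close>
  have "generate G {g} = (\<lambda>k. g [^] k) ` {1..ord g}"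
  proof
    show "(\<lambda>k. g [^] k) ` {1..ord g} \<subseteq> generate G {g}"
      using generate_pow_on_finite_carrier[OF assms] by auto
    show "generate G {g} \<subseteq> (\<lambda>k. g [^] k) ` {1..ord g}"
    proof
      fix x assume "x \<in> generate G {g}"
      then have "x \<in> {g [^] k |k. k \<in> {0..ord g - 1}}"
        by (simp only: generate_pow_on_finite_carrier[OF assms] ord_elems[OF assms])
      then obtain k where k: "x = g [^] k" "k \<le> ord g - 1" by auto
      show "x \<in> (\<lambda>k. g [^] k) ` {1..ord g}"
      proof (cases "k = 0")
        case True
        then have "x = g [^] ord g" using k g by simp
        then show ?thesis using pos by force
      next
        case False
        then show ?thesis using k pos by force
      qed
    qed
  qed
  then have "{x \<in> generate G {g}. ord x = ord g} = (\<lambda>k. g [^] k) ` {k \<in> {1..ord g}. ord (g [^] k) = ord g}"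
    by auto
  also have "{k \<in> {1..ord g}. ord (g [^] k) = ord g} = totatives (ord g)"
    by (auto simp: totatives_def pow_ord_eq_ord_iff[OF assms])
  also have "card ((\<lambda>k. g [^] k) ` totatives (ord g)) = card (totatives (ord g))"
    by (rule card_image, rule inj_on_subset[OF ord_inj'[OF g]]) (auto simp: totatives_def)
  finally show ?thesis by (simp add: totient_def)
qed

text \<open>The generators of one cyclic subgroup share their order and number
  \<open>totient\<close> of it, so every fibre of \<open>?f\<close> has total weight 1.\<close>

lemma card_cyclic_subgroups:
  assumes fin: "finite (carrier G)"
  shows "real (card (cyclic_subgroups G)) = cyclic_weight G (carrier G)"
proof -
  let ?f = "\<lambda>x. generate G {x}"
  have fibre: "sum (\<lambda>x. 1 / real (totient (ord x))) {x \<in> carrier G. ?f x = H} = 1"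
    if H: "H \<in> ?f ` carrier G" for H
  proof -
    from H obtain g where g: "g \<in> carrier G" "H = ?f g" by auto
    have "?f g \<subseteq> carrier G" using g generate_incl[of "{g}"] by auto
    then have eq: "{x \<in> carrier G. ?f x = H} = {x \<in> generate G {g}. ord x = ord g}"
      using generate_singleton_eq_iff[OF fin g(1)] g(2) by auto
    have "ord g > 0" using ord_ge_1[OF fin g(1)] by simp
    then show ?thesis
      unfolding eq using card_generators[OF fin g(1)] by simp
  qed
  have "cyclic_weight G (carrier G)
      = (\<Sum>H\<in>?f ` carrier G. sum (\<lambda>x. 1 / real (totient (ord x))) {x \<in> carrier G. ?f x = H})"
    unfolding cyclic_weight_def by (rule sum.image_gen[OF fin])
  then show ?thesis
    using fibre by (simp add: cyclic_subgroups_eq_image_generate)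
qed

section \<open>Element orders and weights in subgroups of prime and prime square order\<close>

lemma ord_dvd_card_subgroup:
  assumes "subgroup H G" "x \<in> H"
  shows "ord x dvd card H"
proof -
  interpret H: group "G\<lparr>carrier := H\<rparr>"
    using assms(1) by (rule subgroup_imp_group)
  have "x [^] card H = \<one>"
    using H.pow_order_eq_1[of x] assms by (simp add: order_def nat_pow_consistent[symmetric])
  then show ?thesis
    using assms pow_eq_id subgroup.mem_carrier by metis
qed

lemma ord_prime_card_subgroup:
  assumes "subgroup H G" "card H = q" "Factorial_Ring.prime q" "x \<in> H" "x \<noteq> \<one>"
  shows "ord x = q"
proof -
  have "ord x dvd q" using ord_dvd_card_subgroup[OF assms(1,4)] assms(2) by simp
  moreover have "x \<in> carrier G" by (rule subgroup.mem_carrier[OF assms(1,4)])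
  then have "ord x \<noteq> 1" using ord_eq_1 assms(5) by simp
  ultimately show ?thesis using assms(3) prime_nat_iff by blast
qed

text \<open>Any nontrivial element generates a group of prime order. The bound on the exponent later
  lets exponents be counted as residues modulo \<open>q\<close>.\<close>

lemma prime_card_subgroup_eq_powers:
  assumes fin: "finite (carrier G)" and H: "subgroup H G" "card H = q" and q: "Factorial_Ring.prime q"
    and v: "v \<in> H" "v \<noteq> \<one>" and w: "w \<in> H"
  shows "\<exists>n<q. w = v [^] (n::nat)"
proof -
  have vG: "v \<in> carrier G" by (rule subgroup.mem_carrier[OF H(1) v(1)])
  have ov: "ord v = q" by (rule ord_prime_card_subgroup[OF H q v])
  have "generate G {v} \<subseteq> H"
    using generate_subgroup_incl[OF _ H(1)] v by auto
  moreover have "finite H" by (rule finite_subset[OF subgroup.subset[OF H(1)] fin])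
  ultimately have "generate G {v} = H"
    using generate_pow_card[OF vG] ov H(2) by (intro card_subset_eq) auto
  then have "w \<in> {v [^] x | x. x \<in> {0 .. ord v - 1}}"
    using w by (simp only: generate_pow_on_finite_carrier[OF fin vG] ord_elems[OF fin vG] flip: \<open>generate G {v} = H\<close>)
  then obtain n where "w = v [^] n" "n \<le> ord v - 1" by auto
  then show ?thesis
    using ov prime_gt_0_nat[OF q] by (intro exI[of _ n]) auto
qed

lemma cyclic_weight_one: "cyclic_weight G {\<one>} = 1"
  by (simp add: cyclic_weight_def)

lemma cyclic_weight_remove_one:
  assumes "subgroup H G" "finite H"
  shows "cyclic_weight G H = 1 + cyclic_weight G (H - {\<one>})"
  unfolding cyclic_weight_def
  by (subst sum.remove[OF assms(2) subgroup.one_closed[OF assms(1)]]) simp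

lemma cyclic_weight_prime_order:
  assumes H: "subgroup H G" "card H = q" and q: "Factorial_Ring.prime q"
  shows "cyclic_weight G H = 2"
proof -
  have fin: "finite H" using H(2) prime_gt_0_nat[OF q] card_gt_0_iff by blast
  have "cyclic_weight G H = 1 + cyclic_weight G (H - {\<one>})"
    using cyclic_weight_remove_one[OF H(1) fin] .
  also have "cyclic_weight G (H - {\<one>}) = (\<Sum>x\<in>H - {\<one>}. 1 / real (totient q))"
    unfolding cyclic_weight_def using ord_prime_card_subgroup[OF H q] by (intro sum.cong) auto
  also have "\<dots> = 1"
    using H(2) subgroup.one_closed[OF H(1)] fin totient_prime[OF q] prime_gt_1_nat[OF q]
    by (simp add: card_Diff_singleton)
  finally show ?thesis by simp
qed

text \<open>Orders in \<open>P\<close> divide the square of \<open>p\<close>. If that square occurs,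
  \<open>P\<close> is cyclic with three subgroups; otherwise all nontrivial elements have order
  \<open>p\<close> and weigh \<open>p + 1\<close> together. The exponent statement is kept to rule
  out a trivial centralizer later.\<close>

lemma cyclic_weight_prime_square_order:
  assumes fin: "finite (carrier G)" and P: "subgroup P G" "card P = p\<^sup>2"
    and p: "Factorial_Ring.prime p"
  shows "cyclic_weight G P = 3 \<or> cyclic_weight G P = p + 2 \<and> (\<forall>x\<in>P. x [^] p = \<one>)"
proof -
  have finP: "finite P" by (rule finite_subset[OF subgroup.subset[OF P(1)] fin])
  have p1: "p > 1" using prime_gt_1_nat[OF p] .
  have PG: "x \<in> carrier G" if "x \<in> P" for x by (rule subgroup.mem_carrier[OF P(1) that])
  have ord: "ord x = 1 \<or> ord x = p \<or> ord x = p\<^sup>2" if "x \<in> P" for x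
  proof -
    have "ord x dvd p ^ 2" using ord_dvd_card_subgroup[OF P(1) that] P(2) by simp
    then obtain i where "i \<le> 2" "ord x = p ^ i" using divides_primepow_nat[OF p] by blast
    then show ?thesis by (auto simp: le_Suc_eq numeral_2_eq_2)
  qed
  have rem: "cyclic_weight G P = 1 + cyclic_weight G (P - {\<one>})"
    using cyclic_weight_remove_one[OF P(1) finP] .
  have cardP1: "card (P - {\<one>}) = p\<^sup>2 - 1"
    using subgroup.one_closed[OF P(1)] finP P(2) by (simp add: card_Diff_singleton)
  show ?thesis
  proof (cases "\<exists>g\<in>P. ord g = p\<^sup>2")
    case True
    then obtain g where g: "g \<in> P" "ord g = p\<^sup>2" by blast
    have "generate G {g} \<subseteq> P"
      using generate_subgroup_incl[OF _ P(1)] g by auto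
    then have gen: "generate G {g} = P"
      using generate_pow_card[OF PG[OF g(1)]] g(2) P(2) finP by (intro card_subset_eq) auto
    \<comment> \<open>\<open>A\<close> consists of the generators of \<open>P\<close> and has weight
      1; the \<open>p - 1\<close> elements left besides the identity have order \<open>p\<close> and
      also weigh 1 together.\<close>
    define A where "A = {x \<in> P. ord x = p\<^sup>2}"
    have tot: "totient (p\<^sup>2) = p * (p - 1)"
      using totient_prime_power[OF p, of 2] by simp
    have cardA: "card A = p * (p - 1)"
      using card_generators[OF fin PG[OF g(1)]] g tot gen by (simp add: A_def)
    have "Suc 0 \<noteq> p\<^sup>2" using one_less_power[OF p1, of 2] by simp
    then have AP: "A \<subseteq> P - {\<one>}" by (auto simp: A_def)
    have "cyclic_weight G (P - {\<one>}) = cyclic_weight G A + cyclic_weight G (P - {\<one>} - A)"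
      unfolding cyclic_weight_def using sum.subset_diff[OF AP] finP by (simp add: add.commute)
    moreover have "cyclic_weight G A = (\<Sum>x\<in>A. 1 / real (p * (p - 1)))"
      unfolding cyclic_weight_def by (intro sum.cong) (auto simp: A_def tot)
    then have "cyclic_weight G A = 1" using cardA p1 by simp
    moreover have "cyclic_weight G (P - {\<one>} - A) = (\<Sum>x\<in>P - {\<one>} - A. 1 / real (p - 1))"
      unfolding cyclic_weight_def 
    proof (intro sum.cong refl)
      fix x assume x: "x \<in> P - {\<one>} - A"
      then have "ord x = p" using ord[of x] ord_eq_1[of x] PG[of x] by (auto simp: A_def)
      then show "1 / real (totient (ord x)) = 1 / real (p - 1)" by (simp add: totient_prime[OF p])
    qed
    moreover have "card (P - {\<one>} - A) = p - 1"
    proof -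
      have "card (P - {\<one>} - A) = p\<^sup>2 - 1 - p * (p - 1)"
        using AP finP cardA cardP1 by (simp add: card_Diff_subset finite_subset)
      also have "\<dots> = p - 1" using p1 by (simp add: power2_eq_square diff_mult_distrib2)
      finally show ?thesis .
    qed
    ultimately have "cyclic_weight G P = 3" using rem p1 by simp
    then show ?thesis by simp
  next
    case False
    then have ordp: "ord x = p" if "x \<in> P - {\<one>}" for x
      using that ord[of x] ord_eq_1[of x] PG[of x] by auto
    have "cyclic_weight G (P - {\<one>}) = (\<Sum>x\<in>P - {\<one>}. 1 / real (p - 1))"
      unfolding cyclic_weight_def using ordp by (intro sum.cong) (auto simp: totient_prime[OF p])
    also have "\<dots> = real (p\<^sup>2 - 1) / real (p - 1)" using cardP1 by simp
    also have "p\<^sup>2 - 1 = (p + 1) * (p - 1)" by (simp add: power2_eq_square algebra_simps)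
    also have "real ((p + 1) * (p - 1)) / real (p - 1) = p + 1"
      using p1 by (subst of_nat_mult, subst nonzero_mult_div_cancel_right) auto
    finally have "cyclic_weight G P = p + 2" using rem by simp
    moreover have "\<forall>x\<in>P. x [^] p = \<one>"
    proof
      fix x assume x: "x \<in> P"
      show "x [^] p = \<one>"
      proof (cases "x = \<one>")
        case False
        then show ?thesis using x ordp[of x] pow_eq_id[OF PG[OF x], of p] by simp
      qed simp
    qed
    ultimately show ?thesis by blast
  qed
qed

end

text \<open>The quotient by \<open>Q\<close> has order \<open>m\<close>, so \<open>x [^] m\<close>
  lies in \<open>Q\<close>. Since \<open>m\<close> is coprime to \<open>card Q\<close> and
  \<open>x [^] card Q\<close> is trivial, Bezout writes \<open>x\<close> as a power of
  \<open>x [^] m\<close>.\<close>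

lemma (in group) normal_mem_if_pow_card_eq_one:
  assumes Q: "Q \<lhd> G" and ord: "order G = m * card Q" and cop: "coprime m (card Q)"
    and pos: "card Q > 0" and x: "x \<in> carrier G" "x [^] card Q = \<one>"
  shows "x \<in> Q"
proof -
  interpret Q: normal Q G by (rule Q)
  interpret F: group "G Mod Q" by (rule Q.factorgroup_is_group)
  have sub: "subgroup Q G" by (rule Q.subgroup_axioms)
  have "order (G Mod Q) * card Q = order G"
    using lagrange[OF sub] by (simp add: FactGroup_def order_def)
  then have ordF: "order (G Mod Q) = m" using ord pos by simp
  have "Q #> (x [^] m) = (Q #> x) [^]\<^bsub>G Mod Q\<^esub> m"
    by (rule hom_nat_pow[OF Q.r_coset_hom_Mod x(1) is_group F.is_group])
  also have "\<dots> = \<one>\<^bsub>G Mod Q\<^esub>"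
    using F.pow_order_eq_1[OF hom_in_carrier[OF Q.r_coset_hom_Mod x(1)]] ordF by simp
  finally have "Q #> (x [^] m) = Q" by (simp add: FactGroup_def)
  then have xm: "x [^] m \<in> Q" using coset_join1[OF _ _ sub] x(1) by simp
  have "gcd (int m) (int (card Q)) = 1" using cop by (simp add: coprime_iff_gcd_eq_1)
  then obtain u v where uv: "u * int m + v * int (card Q) = 1"
    using bezout_int[of "int m" "int (card Q)"] by auto
  have "x = x [^] (int m * u + int (card Q) * v)"
    using uv x(1) by (simp add: mult.commute)
  also have "\<dots> = (x [^] m) [^] u \<otimes> (x [^] card Q) [^] v"
    using x(1) by (simp add: int_pow_mult int_pow_pow[symmetric] int_pow_int)
  also have "\<dots> = (x [^] m) [^] u"
    using x by simp
  also have "\<dots> \<in> Q" by (rule subgroup_int_pow_closed[OF sub xm])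
  finally show ?thesis .
qed

section \<open>A normal subgroup of prime order with a coprime complement\<close>

text \<open>\<open>G\<close> is here a semidirect product of \<open>Q\<close> by \<open>P\<close>.
  The order of \<open>P\<close> stays general until the final case distinction.\<close>

locale normal_prime_complement = group G for G (structure) +
  fixes Q P :: "'a set" and q :: nat
  assumes finite_carrier: "finite (carrier G)"
    and Q_normal: "Q \<lhd> G"
    and card_Q: "card Q = q"
    and prime_q: "Factorial_Ring.prime q"
    and subgroup_P: "subgroup P G"
    and order_G: "order G = card P * q"
    and coprime_P_q: "coprime (card P) q"
begin

lemma subgroup_Q: "subgroup Q G"
  using Q_normal by (rule normal_imp_subgroup)

lemma Q_carrier: "u \<in> Q \<Longrightarrow> u \<in> carrier G"
  by (rule subgroup.mem_carrier[OF subgroup_Q])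

lemma P_carrier: "h \<in> P \<Longrightarrow> h \<in> carrier G"
  by (rule subgroup.mem_carrier[OF subgroup_P])

lemma finite_P: "finite P"
  by (rule finite_subset[OF subgroup.subset[OF subgroup_P] finite_carrier])

lemma Q_conj: "u \<in> Q \<Longrightarrow> g \<in> carrier G \<Longrightarrow> g \<otimes> u \<otimes> inv g \<in> Q"
  by (rule normal.inv_op_closed2[OF Q_normal])

lemma Q_Int_P:
  assumes "x \<in> Q" "x \<in> P"
  shows "x = \<one>"
proof -
  have "ord x dvd q" "ord x dvd card P"
    using ord_dvd_card_subgroup[OF subgroup_Q assms(1)] card_Q
      ord_dvd_card_subgroup[OF subgroup_P assms(2)] by simp_all
  then have "ord x = 1"
    using coprime_P_q by (metis coprime_common_divisor_nat)
  then show ?thesis using ord_eq_1[OF Q_carrier[OF assms(1)]] by simp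
qed

text \<open>Coprime orders force a trivial intersection, which gives injectivity; surjectivity
  follows by counting.\<close>

lemma bij_betw_Q_P: "bij_betw (\<lambda>(u, h). u \<otimes> h) (Q \<times> P) (carrier G)"
proof -
  have inj: "inj_on (\<lambda>(u, h). u \<otimes> h) (Q \<times> P)"
  proof (rule inj_onI, clarify)
    fix u h u' h' assume u: "u \<in> Q" "u' \<in> Q" and h: "h \<in> P" "h' \<in> P" and eq: "u \<otimes> h = u' \<otimes> h'"
    note c = Q_carrier[OF u(1)] Q_carrier[OF u(2)] P_carrier[OF h(1)] P_carrier[OF h(2)]
    have "inv u' \<otimes> (u \<otimes> h) \<otimes> inv h = inv u' \<otimes> (u' \<otimes> h') \<otimes> inv h" by (simp add: eq)
    then have e: "inv u' \<otimes> u = h' \<otimes> inv h"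
      using c by (simp add: m_assoc) (simp add: m_assoc[symmetric])
    have "inv u' \<otimes> u \<in> Q"
      by (intro subgroup.m_closed[OF subgroup_Q] subgroup.m_inv_closed[OF subgroup_Q] u)
    moreover have "h' \<otimes> inv h \<in> P"
      by (intro subgroup.m_closed[OF subgroup_P] subgroup.m_inv_closed[OF subgroup_P] h)
    ultimately have "inv u' \<otimes> u = \<one>" "h' \<otimes> inv h = \<one>" using Q_Int_P e by simp_all
    then show "u = u' \<and> h = h'"
      using c by (metis inv_closed inv_equality inv_inv)
  qed
  moreover have "(\<lambda>(u, h). u \<otimes> h) ` (Q \<times> P) = carrier G"
  proof (rule card_subset_eq[OF finite_carrier])
    show "(\<lambda>(u, h). u \<otimes> h) ` (Q \<times> P) \<subseteq> carrier G"
      using Q_carrier P_carrier by auto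
    show "card ((\<lambda>(u, h). u \<otimes> h) ` (Q \<times> P)) = card (carrier G)"
      using card_image[OF inj] card_Q order_G by (simp add: card_cartesian_product order_def)
  qed
  ultimately show ?thesis by (simp add: bij_betw_def)
qed

definition K :: "'a set" where
  "K = {h \<in> P. \<forall>u\<in>Q. u \<otimes> h = h \<otimes> u}"

text \<open>A nontrivial \<open>v\<close> generates \<open>Q\<close>, so centralizing
  \<open>v\<close> already means centralizing \<open>Q\<close>.\<close>

lemma commute_Q_if_commute_one:
  assumes v: "v \<in> Q" "v \<noteq> \<one>" and h: "h \<in> carrier G" "v \<otimes> h = h \<otimes> v" and u: "u \<in> Q"
  shows "u \<otimes> h = h \<otimes> u"
proof -
  obtain n :: nat where "u = v [^] n"
    using prime_card_subgroup_eq_powers[OF finite_carrier subgroup_Q card_Q prime_q v u] by blast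
  then show ?thesis
    using group_commutes_pow[OF h(2) Q_carrier[OF v(1)] h(1)] by simp
qed

lemma exists_nontrivial_Q: "\<exists>v\<in>Q. v \<noteq> \<one>"
proof (rule ccontr)
  assume "\<not> (\<exists>v\<in>Q. v \<noteq> \<one>)"
  then have "card Q \<le> card {\<one>}" by (intro card_mono) auto
  then show False using card_Q prime_gt_1_nat[OF prime_q] by simp
qed

lemma subgroup_K: "subgroup K G"
proof (rule subgroupI)
  show "K \<subseteq> carrier G" using P_carrier by (auto simp: K_def)
  show "K \<noteq> {}"
    using subgroup.one_closed[OF subgroup_P] Q_carrier by (auto simp: K_def intro!: exI[of _ \<one>])
next
  fix h assume h: "h \<in> K"
  have "u \<otimes> inv h = inv h \<otimes> u" if u: "u \<in> Q" for u
  proof -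
    have c: "u \<in> carrier G" "h \<in> carrier G" "u \<otimes> h = h \<otimes> u"
      using u h Q_carrier P_carrier by (auto simp: K_def)
    have "inv h \<otimes> u = inv h \<otimes> (u \<otimes> h) \<otimes> inv h" using c(1,2) by (simp add: m_assoc)
    also have "\<dots> = inv h \<otimes> (h \<otimes> u) \<otimes> inv h" by (simp add: c(3))
    also have "\<dots> = u \<otimes> inv h" using c(1,2) by (simp add: m_assoc[symmetric])
    finally show ?thesis by simp
  qed
  then show "inv h \<in> K"
    using h subgroup.m_inv_closed[OF subgroup_P] by (auto simp: K_def)
next
  fix h k assume h: "h \<in> K" and k: "k \<in> K"
  have "u \<otimes> (h \<otimes> k) = h \<otimes> k \<otimes> u" if u: "u \<in> Q" for u
  proof -
    have c: "u \<in> carrier G" "h \<in> carrier G" "k \<in> carrier G" "u \<otimes> h = h \<otimes> u" "u \<otimes> k = k \<otimes> u"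
      using u h k Q_carrier P_carrier by (auto simp: K_def)
    have "u \<otimes> (h \<otimes> k) = (u \<otimes> h) \<otimes> k" using c(1-3) by (simp add: m_assoc)
    also have "\<dots> = h \<otimes> (u \<otimes> k)" using c(1-3) by (simp add: c(4) m_assoc)
    also have "\<dots> = h \<otimes> k \<otimes> u" using c(1-3) by (simp add: c(5) m_assoc)
    finally show ?thesis .
  qed
  then show "h \<otimes> k \<in> K"
    using h k subgroup.m_closed[OF subgroup_P] by (auto simp: K_def)
qed

text \<open>The factors commute and their powers lie in subgroups meeting trivially, so a power of
  the product vanishes only if both factors' powers do; coprime orders then multiply.\<close>

lemma ord_mult_K:
  assumes u: "u \<in> Q" and h: "h \<in> K"
  shows "ord (u \<otimes> h) = ord u * ord h"
proof -
  have hP: "h \<in> P" and comm: "u \<otimes> h = h \<otimes> u" using u h by (auto simp: K_def)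
  note c = Q_carrier[OF u] P_carrier[OF hP]
  have cop: "coprime (ord u) (ord h)"
    using ord_dvd_card_subgroup[OF subgroup_Q u] ord_dvd_card_subgroup[OF subgroup_P hP]
      coprime_P_q card_Q by (metis coprime_commute coprime_divisors)
  have "(u \<otimes> h) [^] n = \<one> \<longleftrightarrow> ord u * ord h dvd n" for n :: nat
  proof -
    have eq: "(u \<otimes> h) [^] n = u [^] n \<otimes> h [^] n"
      by (rule pow_mult_distrib[OF comm c])
    have "u [^] n \<otimes> h [^] n = \<one> \<longleftrightarrow> u [^] n = \<one> \<and> h [^] n = \<one>"
    proof
      assume e: "u [^] n \<otimes> h [^] n = \<one>"
      then have "u [^] n = inv (h [^] n)" using c by (simp add: inv_equality)
      moreover have "inv (h [^] n) \<in> P"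
        using subgroup.m_inv_closed[OF subgroup_P] subgroup_int_pow_closed[OF subgroup_P hP, of "int n"]
        by (simp add: int_pow_int)
      moreover have "u [^] n \<in> Q"
        using subgroup_int_pow_closed[OF subgroup_Q u, of "int n"] by (simp add: int_pow_int)
      ultimately have "u [^] n = \<one>" using Q_Int_P by simp
      then show "u [^] n = \<one> \<and> h [^] n = \<one>" using e c by simp
    qed simp
    also have "\<dots> \<longleftrightarrow> ord u dvd n \<and> ord h dvd n"
      using c by (simp add: pow_eq_id)
    also have "\<dots> \<longleftrightarrow> ord u * ord h dvd n"
      using cop by (meson divides_mult dvd_mult_left dvd_mult_right)
    finally show ?thesis by (simp add: eq)
  qed
  then show ?thesis using c by (subst ord_unique) auto
qed

text \<open>\<open>u \<otimes> h\<close> and \<open>h\<close> have the same image modulo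
  \<open>Q\<close>. In the induction each new \<open>u\<close> is moved left past
  \<open>h [^] n\<close> by conjugation, which keeps it in \<open>Q\<close>.\<close>

lemma pow_mult_Q:
  assumes u: "u \<in> Q" and h: "h \<in> carrier G"
  shows "\<exists>w\<in>Q. (u \<otimes> h) [^] (n::nat) = w \<otimes> h [^] n"
proof (induction n)
  case 0
  show ?case using subgroup.one_closed[OF subgroup_Q] by (intro bexI[of _ \<one>]) simp_all
next
  case (Suc n)
  then obtain w where w: "w \<in> Q" "(u \<otimes> h) [^] n = w \<otimes> h [^] n" by blast
  define u' where "u' = h [^] n \<otimes> u \<otimes> inv (h [^] n)"
  have u': "u' \<in> Q" unfolding u'_def using u h by (intro Q_conj) simp_all
  note c = Q_carrier[OF u] Q_carrier[OF w(1)] h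
  have "(u \<otimes> h) [^] Suc n = (w \<otimes> u') \<otimes> h [^] Suc n"
    using c unfolding u'_def by (simp add: w(2) m_assoc) (simp add: m_assoc[symmetric])
  then show ?case
    using subgroup.m_closed[OF subgroup_Q w(1) u'] by blast
qed

text \<open>A nontrivial power of \<open>u \<otimes> h\<close> in \<open>Q\<close> would generate the abelian group \<open>Q\<close>, so \<open>h\<close> would
  centralize \<open>Q\<close>.\<close>

lemma ord_mult_not_K:
  assumes u: "u \<in> Q" and h: "h \<in> P" "h \<notin> K"
  shows "ord (u \<otimes> h) = ord h"
proof -
  note c = Q_carrier[OF u] P_carrier[OF h(1)]
  have "(u \<otimes> h) [^] n = \<one> \<longleftrightarrow> ord h dvd n" for n :: nat
  proof -
    obtain w where w: "w \<in> Q" "(u \<otimes> h) [^] n = w \<otimes> h [^] n"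
      using pow_mult_Q[OF u c(2)] by blast
    note cw = Q_carrier[OF w(1)]
    have hn: "h [^] n \<in> P"
      using subgroup_int_pow_closed[OF subgroup_P h(1), of "int n"] by (simp add: int_pow_int)
    have "(u \<otimes> h) [^] n = \<one> \<longleftrightarrow> h [^] n = \<one>"
    proof
      assume "(u \<otimes> h) [^] n = \<one>"
      then have e: "w \<otimes> h [^] n = \<one>" using w(2) by simp
      then have "w = inv (h [^] n)" using c cw by (simp add: inv_equality)
      then have "w \<in> P" using subgroup.m_inv_closed[OF subgroup_P hn] by simp
      then have "w = \<one>" using Q_Int_P w(1) by simp
      then show "h [^] n = \<one>" using e c by simp
    next
      assume "h [^] n = \<one>"
      then have uhn: "(u \<otimes> h) [^] n = w" using w(2) cw by simp
      show "(u \<otimes> h) [^] n = \<one>"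
      proof (rule ccontr)
        assume "(u \<otimes> h) [^] n \<noteq> \<one>"
        then have w1: "w \<noteq> \<one>" using uhn by simp
        have uw: "u \<otimes> w = w \<otimes> u"
          using commute_Q_if_commute_one[OF w(1) w1 cw refl u] .
        \<comment> \<open>Being a power of \<open>u \<otimes> h\<close>, \<open>w\<close> commutes
          with it; as \<open>w\<close> also commutes with \<open>u\<close>, cancelling
          \<open>u\<close> leaves \<open>h\<close>.\<close>
        have "w \<otimes> (u \<otimes> h) = (u \<otimes> h) \<otimes> w"
          using group_commutes_pow[of "u \<otimes> h" "u \<otimes> h" n] c uhn by simp
        then have "u \<otimes> (w \<otimes> h) = u \<otimes> (h \<otimes> w)"
          using c cw uw by (simp add: m_assoc[symmetric])
        then have "w \<otimes> h = h \<otimes> w" using c cw by simp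
        then have "h \<in> K"
          using commute_Q_if_commute_one[OF w(1) w1 c(2)] h(1) by (simp add: K_def)
        with h(2) show False ..
      qed
    qed
    then show ?thesis using c by (simp add: pow_eq_id)
  qed
  then show ?thesis using c by (subst ord_unique) auto
qed

text \<open>The sum is taken over pairs in \<open>Q \<times> P\<close> and split at
  \<open>K\<close>. For \<open>h\<close> in \<open>K\<close>, multiplicativity of
  \<open>totient\<close> yields the factor 2, the weight of \<open>Q\<close>; for other
  \<open>h\<close> the weight does not depend on \<open>u\<close>, which yields the factor
  \<open>q\<close>.\<close>

lemma cyclic_weight_carrier:
  "cyclic_weight G (carrier G) = 2 * cyclic_weight G K + q * (cyclic_weight G P - cyclic_weight G K)"
proof -
  let ?w = "\<lambda>x. 1 / real (totient (ord x))"
  have KP: "K \<subseteq> P" by (auto simp: K_def)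
  have Q2: "sum ?w Q = 2"
    using cyclic_weight_prime_order[OF subgroup_Q card_Q prime_q] by (simp add: cyclic_weight_def)
  have inK: "(\<Sum>u\<in>Q. ?w (u \<otimes> h)) = 2 * ?w h" if h: "h \<in> K" for h
  proof -
    have "(\<Sum>u\<in>Q. ?w (u \<otimes> h)) = (\<Sum>u\<in>Q. ?w u * ?w h)"
    proof (rule sum.cong[OF refl])
      fix u assume u: "u \<in> Q"
      have "h \<in> P" using h by (simp add: K_def)
      then have "coprime (ord u) (ord h)"
        using ord_dvd_card_subgroup[OF subgroup_Q u] ord_dvd_card_subgroup[OF subgroup_P, of h]
          coprime_P_q card_Q by (metis coprime_commute coprime_divisors)
      then show "?w (u \<otimes> h) = ?w u * ?w h"
        by (simp add: ord_mult_K[OF u h] totient_mult_coprime)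
    qed
    also have "\<dots> = sum ?w Q * ?w h"
      by (rule sum_distrib_right[symmetric])
    finally show ?thesis by (simp only: Q2)
  qed
  have notK: "(\<Sum>u\<in>Q. ?w (u \<otimes> h)) = q * ?w h" if "h \<in> P - K" for h
    using that ord_mult_not_K card_Q by simp
  have "cyclic_weight G (carrier G) = (\<Sum>(u, h)\<in>Q \<times> P. ?w (u \<otimes> h))"
    unfolding cyclic_weight_def
    using sum.reindex_bij_betw[OF bij_betw_Q_P, of ?w] by (simp add: case_prod_unfold)
  also have "\<dots> = (\<Sum>u\<in>Q. \<Sum>h\<in>P. ?w (u \<otimes> h))"
    by (simp add: sum.cartesian_product)
  also have "\<dots> = (\<Sum>h\<in>P. \<Sum>u\<in>Q. ?w (u \<otimes> h))"
    by (rule sum.swap)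
  also have "\<dots> = (\<Sum>h\<in>P - K. \<Sum>u\<in>Q. ?w (u \<otimes> h)) + (\<Sum>h\<in>K. \<Sum>u\<in>Q. ?w (u \<otimes> h))"
    by (rule sum.subset_diff[OF KP finite_P])
  also have "\<dots> = q * sum ?w (P - K) + 2 * sum ?w K"
    using inK notK by (simp add: sum_distrib_left)
  also have "sum ?w (P - K) = sum ?w P - sum ?w K"
    using sum.subset_diff[OF KP finite_P, of ?w] by simp
  finally show ?thesis by (simp add: cyclic_weight_def)
qed

text \<open>Conjugation by \<open>h\<close> raises a generator \<open>v\<close> of \<open>Q\<close> to a power \<open>r h\<close> with \<open>(r h)\<^sup>n \<equiv> 1 (mod q)\<close>;
  there are at most \<open>n\<close> such exponents.\<close>

lemma K_nontrivial:
  assumes n: "n > 0" "n < card P" and exp: "\<And>h. h \<in> P \<Longrightarrow> h [^] n = \<one>"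
  shows "K \<noteq> {\<one>}"
proof -
  obtain v where v: "v \<in> Q" "v \<noteq> \<one>" using exists_nontrivial_Q by blast
  note cv = Q_carrier[OF v(1)]
  have "\<exists>r<q. h \<otimes> v = v [^] (r::nat) \<otimes> h" if h: "h \<in> P" for h
  proof -
    note ch = P_carrier[OF h]
    obtain r where r: "r < q" "h \<otimes> v \<otimes> inv h = v [^] (r::nat)"
      using prime_card_subgroup_eq_powers[OF finite_carrier subgroup_Q card_Q prime_q v Q_conj[OF v(1) ch]]
      by blast
    have "v [^] r \<otimes> h = h \<otimes> v"
      using cv ch by (simp add: r(2)[symmetric] m_assoc)
    then show ?thesis using r(1) by auto
  qed
  then obtain r where r: "\<And>h. h \<in> P \<Longrightarrow> r h < q" "\<And>h. h \<in> P \<Longrightarrow> h \<otimes> v = v [^] (r h) \<otimes> h"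
    by metis
  \<comment> \<open>Conjugating \<open>m\<close> times by \<open>h\<close> raises \<open>v\<close>
    to the power \<open>r h ^ m\<close>.\<close>
  have pow: "h [^] m \<otimes> v [^] k = v [^] (r h ^ m * k) \<otimes> h [^] m" if h: "h \<in> P" for h and m k :: nat
  proof -
    note ch = P_carrier[OF h]
    have step: "h \<otimes> v [^] k = v [^] (r h * k) \<otimes> h" for k :: nat
    proof (induction k)
      case 0
      show ?case using ch by simp
    next
      case (Suc k)
      have "h \<otimes> v [^] Suc k = (h \<otimes> v [^] k) \<otimes> v" using ch cv by (simp add: m_assoc)
      also have "\<dots> = v [^] (r h * k) \<otimes> (h \<otimes> v)" using ch cv by (simp add: Suc m_assoc)
      also have "\<dots> = v [^] (r h * k) \<otimes> v [^] (r h) \<otimes> h" using ch cv by (simp add: r(2)[OF h] m_assoc)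
      also have "\<dots> = v [^] (r h * Suc k) \<otimes> h" using cv by (simp add: nat_pow_mult add.commute)
      finally show ?case .
    qed
    show ?thesis
    proof (induction m arbitrary: k)
      case 0
      show ?case using cv by simp
    next
      case (Suc m)
      have "h [^] Suc m \<otimes> v [^] k = h [^] m \<otimes> (h \<otimes> v [^] k)" using ch cv by (simp add: m_assoc)
      also have "\<dots> = (h [^] m \<otimes> v [^] (r h * k)) \<otimes> h" using ch cv by (simp add: step m_assoc)
      also have "\<dots> = v [^] (r h ^ Suc m * k) \<otimes> h [^] Suc m"
        using ch cv by (simp add: Suc m_assoc mult.left_commute mult.assoc)
      finally show ?case .
    qed
  qed
  have root: "[r h ^ n = 1] (mod q)" if h: "h \<in> P" for h
  proof -
    have "v [^] (r h ^ n) = v [^] (1::nat)"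
      using pow[OF h, of n 1] exp[OF h] cv by simp
    then have "v [^] int (r h ^ n) = v [^] int 1"
      by (simp only: int_pow_int)
    then have "int (ord v) dvd int 1 - int (r h ^ n)"
      using int_pow_eq[OF cv] by blast
    then have "[int 1 = int (r h ^ n)] (mod int q)"
      using ord_prime_card_subgroup[OF subgroup_Q card_Q prime_q v] by (simp add: cong_iff_dvd_diff)
    then show ?thesis by (metis cong_int_iff cong_sym)
  qed
  have "\<not> inj_on r P"
  proof
    assume "inj_on r P"
    then have "card P = card (r ` P)" by (simp add: card_image)
    also have "\<dots> \<le> card {x \<in> {..<q}. [x ^ n = 1] (mod q)}"
      using root r(1) by (intro card_mono) auto
    also have "\<dots> \<le> n" by (rule roots_mod_prime_bound[OF prime_q n(1)])
    finally show False using n(2) by simp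
  qed
  \<comment> \<open>Two elements acting on \<open>v\<close> with the same exponent differ by an
    element centralizing \<open>v\<close>, which is the required nontrivial member of
    \<open>K\<close>.\<close>
  then obtain h h' where h: "h \<in> P" "h' \<in> P" "h \<noteq> h'" "r h = r h'"
    by (auto simp: inj_on_def)
  note c = P_carrier[OF h(1)] P_carrier[OF h(2)] cv
  have "inv h \<otimes> v [^] (r h) = inv h \<otimes> (v [^] (r h) \<otimes> h) \<otimes> inv h"
    using c by (simp add: m_assoc)
  also have "\<dots> = v \<otimes> inv h"
    using c by (simp add: r(2)[OF h(1), symmetric]) (simp add: m_assoc[symmetric])
  finally have e: "inv h \<otimes> v [^] (r h) = v \<otimes> inv h" .
  have "(inv h \<otimes> h') \<otimes> v = inv h \<otimes> (h' \<otimes> v)" using c by (simp add: m_assoc)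
  also have "\<dots> = (inv h \<otimes> v [^] (r h)) \<otimes> h'" using c by (simp add: r(2)[OF h(2)] h(4) m_assoc)
  also have "\<dots> = v \<otimes> (inv h \<otimes> h')" using c by (simp add: e m_assoc)
  finally have "v \<otimes> (inv h \<otimes> h') = (inv h \<otimes> h') \<otimes> v" by simp
  then have "\<forall>u\<in>Q. u \<otimes> (inv h \<otimes> h') = (inv h \<otimes> h') \<otimes> u"
    using commute_Q_if_commute_one[OF v, of "inv h \<otimes> h'"] c by simp
  moreover have "inv h \<otimes> h' \<in> P"
    by (intro subgroup.m_closed[OF subgroup_P] subgroup.m_inv_closed[OF subgroup_P] h)
  ultimately have "inv h \<otimes> h' \<in> K" by (simp add: K_def)
  moreover have "inv h \<otimes> h' \<noteq> \<one>"
    using h(3) c by (metis inv_closed inv_equality inv_inv)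
  ultimately show ?thesis by blast
qed

end
lemma (in group) card_subgroup_dvd:
  assumes H: "subgroup H G" and P: "subgroup P G" and "H \<subseteq> P"
  shows "card H dvd card P"
proof -
  interpret P: group "G\<lparr>carrier := P\<rparr>" using P by (rule subgroup_imp_group)
  have "subgroup H (G\<lparr>carrier := P\<rparr>)" by (rule subgroup_incl[OF H P \<open>H \<subseteq> P\<close>])
  from P.lagrange[OF this, symmetric] show ?thesis
    by (simp add: order_def)
qed

text \<open>\<open>card K\<close> divides the square of \<open>p\<close>. Trivial \<open>K\<close>
  gives \<open>2 * q + 2\<close>; order \<open>p\<close> gives \<open>q + 4\<close> or
  \<open>p * q + 4\<close>; \<open>K = P\<close> gives 6 or \<open>2 * p + 4\<close>.\<close>

lemma (in normal_prime_complement) cyclic_weight_cases: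
  assumes P: "card P = p\<^sup>2" and p: "Factorial_Ring.prime p"
  shows "cyclic_weight G (carrier G) \<in> real ` {6, 2 * p + 4, p * q + 4, q + 4, 2 * q + 2}"
proof -
  have KP: "K \<subseteq> P" by (auto simp: K_def)
  have "card K dvd p ^ 2"
    using card_subgroup_dvd[OF subgroup_K subgroup_P KP] P by simp
  then obtain i where "i \<le> 2" "card K = p ^ i" using divides_primepow_nat[OF p] by blast
  then consider "card K = 1" | "card K = p" | "card K = p\<^sup>2"
    by (auto simp: le_Suc_eq numeral_2_eq_2)
  then show ?thesis
  proof cases
    case 1
    then have K1: "K = {\<one>}"
      using subgroup.one_closed[OF subgroup_K] by (auto simp: card_1_singleton_iff)
    \<comment> \<open>Exponent \<open>p\<close> would leave at most \<open>p\<close> possible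
      actions on \<open>Q\<close> for more than \<open>p\<close> elements of \<open>P\<close>,
      making \<open>K\<close> nontrivial.\<close>
    have "\<not> (\<forall>h\<in>P. h [^] p = \<one>)"
      using K_nontrivial[of p] K1 P prime_gt_1_nat[OF p] by (auto simp: power2_eq_square)
    then have "cyclic_weight G P = 3"
      using cyclic_weight_prime_square_order[OF finite_carrier subgroup_P P p] by blast
    then show ?thesis
      using cyclic_weight_carrier K1 cyclic_weight_one by simp
  next
    case 2
    then have "cyclic_weight G K = 2" by (rule cyclic_weight_prime_order[OF subgroup_K _ p])
    then show ?thesis
      using cyclic_weight_carrier cyclic_weight_prime_square_order[OF finite_carrier subgroup_P P p]
      by (auto simp: algebra_simps)
  next
    case 3
    then have "K = P" using KP P finite_P by (intro card_subset_eq) auto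
    then show ?thesis
      using cyclic_weight_carrier cyclic_weight_prime_square_order[OF finite_carrier subgroup_P P p]
      by auto
  qed
qed

section \<open>The conjugation action and the non-normal case\<close>

context group
begin

text \<open>The restricted abstraction is the form in which conjugation on subgroups is known to be
  a group action.\<close>

definition subgroup_conj :: "'a \<Rightarrow> 'a set \<Rightarrow> 'a set" where
  "subgroup_conj g = (\<lambda>H \<in> {H. subgroup H G}. g <# H #> inv g)"

lemma group_action_subgroup_conj: "group_action G {H. subgroup H G} subgroup_conj"
  unfolding subgroup_conj_def[abs_def] by (rule action_by_conjugation_on_subgroups_set)

lemma subgroup_conj_eq_image:
  "subgroup H G \<Longrightarrow> subgroup_conj g H = (\<lambda>x. g \<otimes> x \<otimes> inv g) ` H"
  by (auto simp: subgroup_conj_def l_coset_def r_coset_def)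

lemma card_subgroup_conj:
  assumes H: "subgroup H G" and g: "g \<in> carrier G"
  shows "card (subgroup_conj g H) = card H"
proof -
  have "inj_on (\<lambda>x. g \<otimes> x \<otimes> inv g) H"
    using g subgroup.mem_carrier[OF H] by (intro inj_onI) simp
  then show ?thesis by (simp add: subgroup_conj_eq_image[OF H] card_image)
qed

text \<open>The stabilizer under conjugation is the normalizer, which contains the subgroup
  itself.\<close>

lemma subgroup_subset_stabilizer:
  assumes fin: "finite (carrier G)" and H: "subgroup H G"
  shows "H \<subseteq> stabilizer G subgroup_conj H"
proof
  fix x assume x: "x \<in> H"
  have xG: "x \<in> carrier G" by (rule subgroup.mem_carrier[OF H x])
  have "subgroup_conj x H \<subseteq> H"
    unfolding subgroup_conj_eq_image[OF H]
    using subgroup.m_closed[OF H] subgroup.m_inv_closed[OF H] x by blast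
  then have "subgroup_conj x H = H"
    using card_subgroup_conj[OF H xG] finite_subset[OF subgroup.subset[OF H] fin]
    by (intro card_subset_eq) simp_all
  then show "x \<in> stabilizer G subgroup_conj H"
    using xG by (simp add: stabilizer_def)
qed

text \<open>In its normalizer \<open>N\<close>, \<open>H'\<close> is normal of index coprime to
  \<open>q\<close>. It therefore contains every element of \<open>N\<close> whose
  \<open>q\<close>-th power is trivial, in particular all of \<open>H\<close>.\<close>

lemma prime_sylow_unique_in_stabilizer:
  assumes fin: "finite (carrier G)" and ord: "order G = m * q" and cop: "coprime m q"
    and q: "Factorial_Ring.prime q"
    and H: "subgroup H G" "card H = q" and H': "subgroup H' G" "card H' = q"
    and sub: "H \<subseteq> stabilizer G subgroup_conj H'"
  shows "H = H'"
proof -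
  interpret A: group_action G "{H. subgroup H G}" subgroup_conj
    by (rule group_action_subgroup_conj)
  define N where "N = stabilizer G subgroup_conj H'"
  have N: "subgroup N G" unfolding N_def using H' by (intro A.stabilizer_subgroup) simp
  interpret N: group "G\<lparr>carrier := N\<rparr>" using N by (rule subgroup_imp_group)
  have H'N: "H' \<subseteq> N" unfolding N_def by (rule subgroup_subset_stabilizer[OF fin H'(1)])
  obtain k where "card N = card H' * k"
    using card_subgroup_dvd[OF H'(1) N H'N] by (rule dvdE)
  then have k: "card N = k * q" using H'(2) by simp
  have "card N dvd m * q"
    using lagrange[OF N, symmetric] ord by simp
  then have "k dvd m" using k prime_gt_0_nat[OF q] by simp
  then have "coprime k q" by (rule coprime_divisors[OF _ dvd_refl cop])
  have nor: "H' \<lhd> G\<lparr>carrier := N\<rparr>"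
  proof (rule N.normal_invI)
    show "subgroup H' (G\<lparr>carrier := N\<rparr>)" by (rule subgroup_incl[OF H'(1) N H'N])
    fix x h assume x: "x \<in> carrier (G\<lparr>carrier := N\<rparr>)" and h: "h \<in> H'"
    then have "subgroup_conj x H' = H'" by (simp add: N_def stabilizer_def)
    then have "x \<otimes> h \<otimes> inv x \<in> H'"
      using h subgroup_conj_eq_image[OF H'(1), of x] by blast
    then show "x \<otimes>\<^bsub>G\<lparr>carrier := N\<rparr>\<^esub> h \<otimes>\<^bsub>G\<lparr>carrier := N\<rparr>\<^esub> inv\<^bsub>G\<lparr>carrier := N\<rparr>\<^esub> x \<in> H'"
      using x N by simp
  qed
  have "H \<subseteq> H'"
  proof
    fix x assume x: "x \<in> H"
    have "x [^] q = \<one>"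
      using ord_dvd_card_subgroup[OF H(1) x] H(2) pow_eq_id[OF subgroup.mem_carrier[OF H(1) x]] by simp
    then have "x [^]\<^bsub>G\<lparr>carrier := N\<rparr>\<^esub> card H' = \<one>\<^bsub>G\<lparr>carrier := N\<rparr>\<^esub>"
      using H'(2) nat_pow_consistent[of x q N] by simp
    moreover have "x \<in> carrier (G\<lparr>carrier := N\<rparr>)" using x sub by (auto simp: N_def)
    ultimately show "x \<in> H'"
      using N.normal_mem_if_pow_card_eq_one[OF nor, of k x] k \<open>coprime k q\<close> H'(2)
        prime_gt_0_nat[OF q]
      by (simp add: order_def)
  qed
  then show ?thesis
    using H H' finite_subset[OF subgroup.subset[OF H'(1)] fin] by (intro card_subset_eq) auto
qed

text \<open>\<open>S\<close> is the set of conjugates of \<open>Q\<close>; under conjugation by \<open>Q\<close>, all orbits on \<open>S\<close> other than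
  \<open>{Q}\<close> have \<open>q\<close> elements.\<close>

lemma prime_sylow_conjugates:
  assumes fin: "finite (carrier G)" and ord: "order G = m * q" and cop: "coprime m q"
    and q: "Factorial_Ring.prime q" and Q: "subgroup Q G" "card Q = q" and nn: "\<not> Q \<lhd> G"
  shows "\<exists>S. finite S \<and> (\<forall>H\<in>S. subgroup H G \<and> card H = q) \<and>
    card S dvd m \<and> q dvd card S - 1 \<and> card S > 1"
proof -
  let ?E = "{H. subgroup H G}"
  interpret A: group_action G ?E subgroup_conj
    by (rule group_action_subgroup_conj)
  interpret B: group_action "G\<lparr>carrier := Q\<rparr>" ?E subgroup_conj
    by (rule A.induced_action[OF Q(1)])
  define S where "S = orbit G subgroup_conj Q"
  have QE: "Q \<in> ?E" using Q by simp
  have S: "subgroup H G \<and> card H = q" if H: "H \<in> S" for H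
  proof -
    obtain g where g: "g \<in> carrier G" "H = subgroup_conj g Q"
      using H by (auto simp: S_def orbit_def)
    then show ?thesis
      using A.element_image[OF g(1) QE g(2)[symmetric]] card_subgroup_conj[OF Q(1) g(1)] Q(2) by simp
  qed
  have finS: "finite S"
  proof (rule finite_subset)
    show "S \<subseteq> Pow (carrier G)"
    proof
      fix H assume "H \<in> S"
      then have "subgroup H G" by (simp add: S)
      then show "H \<in> Pow (carrier G)" by (simp add: subgroup.subset)
    qed
  qed (simp add: fin)
  have QS: "Q \<in> S" unfolding S_def by (rule A.orbit_refl[OF QE])
  \<comment> \<open>The stabilizer contains \<open>Q\<close>, so \<open>q\<close> divides its order
    and cancels in the orbit-stabilizer equation.\<close>
  have "card S dvd m"
  proof -
    let ?N = "stabilizer G subgroup_conj Q"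
    have N: "subgroup ?N G" by (rule A.stabilizer_subgroup[OF QE])
    obtain k where "card ?N = card Q * k"
      using card_subgroup_dvd[OF Q(1) N subgroup_subset_stabilizer[OF fin Q(1)]] by (rule dvdE)
    then have k: "card ?N = q * k" using Q(2) by simp
    have "card S * (q * k) = m * q"
      using A.orbit_stabilizer_theorem[OF QE] k ord by (simp add: S_def)
    then have "(card S * k) * q = m * q" by (simp add: ac_simps)
    then have "card S * k = m" using prime_gt_0_nat[OF q] by simp
    then show ?thesis by (rule dvdI[OF sym])
  qed
  moreover have "card S > 1"
  proof -
    have "S \<noteq> {Q}"
    proof
      assume S1: "S = {Q}"
      have "Q \<lhd> G"
      proof (rule normal_invI[OF Q(1)])
        fix x h assume x: "x \<in> carrier G" and h: "h \<in> Q"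
        have "subgroup_conj x Q \<in> S" using x by (auto simp: S_def orbit_def)
        then have "subgroup_conj x Q = Q" using S1 by simp
        then show "x \<otimes> h \<otimes> inv x \<in> Q"
          using h subgroup_conj_eq_image[OF Q(1), of x] by blast
      qed
      with nn show False ..
    qed
    then have "{Q} \<subset> S" using QS by blast
    then have "card {Q} < card S" by (rule psubset_card_mono[OF finS])
    then show ?thesis by simp
  qed
  moreover have "q dvd card S - 1"
  proof -
    let ?o = "orbit (G\<lparr>carrier := Q\<rparr>) subgroup_conj"
    have conjQ: "subgroup_conj u Q = Q" if "u \<in> Q" for u
      using subsetD[OF subgroup_subset_stabilizer[OF fin Q(1)] that] by (simp add: stabilizer_def)
    have oQ: "?o Q \<subseteq> {Q}" using conjQ by (auto simp: orbit_def)
    have un: "\<Union>(?o ` (S - {Q})) = S - {Q}"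
    proof
      show "S - {Q} \<subseteq> \<Union>(?o ` (S - {Q}))" using B.orbit_refl S by blast
      show "\<Union>(?o ` (S - {Q})) \<subseteq> S - {Q}"
      proof
        fix H assume "H \<in> \<Union>(?o ` (S - {Q}))"
        then obtain H' where H': "H' \<in> S" "H' \<noteq> Q" "H \<in> ?o H'" by blast
        then have H'E: "H' \<in> ?E" using S by blast
        obtain u where u: "u \<in> Q" "H = subgroup_conj u H'"
          using H'(3) by (auto simp: orbit_def)
        have uG: "u \<in> carrier G" by (rule subgroup.mem_carrier[OF Q(1) u(1)])
        have HE: "H \<in> ?E" by (rule A.element_image[OF uG H'E u(2)[symmetric]])
        have "H \<in> orbit G subgroup_conj H'" using uG u(2) by (auto simp: orbit_def)
        then have "H \<in> S" unfolding S_def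
          using A.orbit_trans[OF QE H'E HE] H'(1) S_def by blast
        moreover have "H \<noteq> Q" using B.orbit_sym[OF H'E HE H'(3)] oQ H'(2) by blast
        ultimately show "H \<in> S - {Q}" by blast
      qed
    qed
    have dvd: "q dvd card (?o H)" if H: "H \<in> S - {Q}" for H
    proof -
      have HE: "H \<in> ?E" using H S by blast
      let ?s = "stabilizer (G\<lparr>carrier := Q\<rparr>) subgroup_conj H"
      have os: "card (?o H) * card ?s = q"
        using B.orbit_stabilizer_theorem[OF HE] Q(2) by (simp add: order_def)
      \<comment> \<open>A one-element orbit would mean that \<open>Q\<close> normalizes
        \<open>H\<close>, forcing \<open>Q = H\<close>. Orbit sizes divide the prime
        \<open>q\<close>, so only \<open>q\<close> remains.\<close>
      have "card (?o H) \<noteq> 1"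
      proof
        assume "card (?o H) = 1"
        then have "card ?s = q" using os by simp
        moreover have "?s \<subseteq> Q" by (auto simp: stabilizer_def)
        ultimately have "?s = Q"
          using Q(2) finite_subset[OF subgroup.subset[OF Q(1)] fin] by (intro card_subset_eq) simp_all
        have "Q \<subseteq> stabilizer G subgroup_conj H"
        proof
          fix u assume u: "u \<in> Q"
          then have "u \<in> ?s" by (simp only: \<open>?s = Q\<close>)
          then show "u \<in> stabilizer G subgroup_conj H"
            using subgroup.mem_carrier[OF Q(1) u] by (simp add: stabilizer_def)
        qed
        then have "Q = H"
          using prime_sylow_unique_in_stabilizer[OF fin ord cop q Q] S[of H] H by simp
        with H show False by blast
      qed
      moreover have "card (?o H) dvd q" by (rule dvdI[OF os[symmetric]])
      ultimately show ?thesis using q by (auto simp: prime_nat_iff)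
    qed
    have disj: "c1 \<inter> c2 = {}" if "c1 \<in> ?o ` (S - {Q})" "c2 \<in> ?o ` (S - {Q})" "c1 \<noteq> c2" for c1 c2
    proof -
      have "?o ` (S - {Q}) \<subseteq> orbits (G\<lparr>carrier := Q\<rparr>) ?E subgroup_conj"
        using S by (auto simp: orbits_def)
      then show ?thesis using that B.disjoint_union by blast
    qed
    have "q dvd card (\<Union>(?o ` (S - {Q})))"
    proof (rule dvd_partition)
      show "finite (\<Union>(?o ` (S - {Q})))" using finS by (simp only: un finite_Diff)
    qed (use dvd disj in blast)+
    then show ?thesis using un QS finS by (simp add: card_Diff_singleton)
  qed
  ultimately show ?thesis using finS S by (intro exI[of _ S]) simp
qed

text \<open>A common nontrivial element generates both subgroups. Hence distinct conjugates of
  \<open>Q\<close> share only the identity.\<close>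

lemma prime_subgroups_eq_if_common_element:
  assumes fin: "finite (carrier G)" and q: "Factorial_Ring.prime q"
    and H: "subgroup H G" "card H = q" and H': "subgroup H' G" "card H' = q"
    and x: "x \<in> H" "x \<in> H'" "x \<noteq> \<one>"
  shows "H = H'"
proof -
  have "H \<subseteq> H'"
  proof
    fix w assume "w \<in> H"
    then obtain n :: nat where "w = x [^] n"
      using prime_card_subgroup_eq_powers[OF fin H q x(1,3)] by blast
    then show "w \<in> H'"
      using subgroup_int_pow_closed[OF H'(1) x(2), of "int n"] by (simp add: int_pow_int)
  qed
  then show ?thesis
    using H H' finite_subset[OF subgroup.subset[OF H'(1)] fin] by (intro card_subset_eq) auto
qed

lemma cyclic_weight_sylow_not_normal:
  assumes fin: "finite (carrier G)" and p: "Factorial_Ring.prime p" and q: "Factorial_Ring.prime q"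
    and pq: "p < q" and ord: "order G = p\<^sup>2 * q"
    and P: "subgroup P G" "card P = p\<^sup>2" and Q: "subgroup Q G" "card Q = q" and nn: "\<not> Q \<lhd> G"
  shows "p = 2" "q = 3" "cyclic_weight G (carrier G) = cyclic_weight G P + 4"
proof -
  have cop: "coprime (p\<^sup>2) q" using p q pq by (simp add: primes_coprime)
  from prime_sylow_conjugates[OF fin ord cop q Q nn]
  obtain S where "finite S" and S_sub: "\<forall>H\<in>S. subgroup H G \<and> card H = q"
    and "card S dvd p\<^sup>2" "q dvd card S - 1" "card S > 1"
    by (elim exE conjE)
  note S = \<open>finite S\<close> bspec[OF S_sub] \<open>card S dvd p\<^sup>2\<close> \<open>q dvd card S - 1\<close> \<open>card S > 1\<close>
  obtain i where i: "i \<le> 2" "card S = p ^ i" using divides_primepow_nat[OF p] S(3) by blast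
  have p1: "p > 1" using prime_gt_1_nat[OF p] .
  \<comment> \<open>The number of conjugates is a power of \<open>p\<close> greater than 1. Since
    \<open>p - 1\<close> is positive and less than \<open>q\<close>, it is not \<open>p\<close>, so
    it is the square of \<open>p\<close>.\<close>
  have "\<not> q dvd p - 1" using p1 pq by (auto dest: dvd_imp_le)
  then have "i \<noteq> 1" using i S(4) by auto
  moreover have "i \<noteq> 0" using i(2) S(5) by (cases i) auto
  ultimately have "i = 2" using i(1) by simp
  then have cardS: "card S = p\<^sup>2" using i by simp
  have "p\<^sup>2 - 1 = (p - 1) * (p + 1)" by (simp add: power2_eq_square algebra_simps)
  then have "q dvd (p - 1) * (p + 1)" using S(4) cardS by simp
  then have "q dvd p + 1" using \<open>\<not> q dvd p - 1\<close> prime_dvd_multD[OF q] by blast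
  then have qp: "q = p + 1" using pq dvd_imp_le[of q "p + 1"] by simp
  \<comment> \<open>\<open>p\<close> and \<open>q\<close> are now consecutive primes; an odd
    \<open>p\<close> would make \<open>q\<close> even.\<close>
  have "p = 2"
  proof (rule ccontr)
    assume "p \<noteq> 2"
    then have "odd p" using prime_odd_nat[OF p] p1 by simp
    then have "even q" using qp by simp
    then show False using prime_odd_nat[OF q] qp p1 by simp
  qed
  then show "p = 2" "q = 3" using qp by simp_all
  have ordx: "ord x = 3" if "H \<in> S" "x \<in> H - {\<one>}" for H x
    using ord_prime_card_subgroup[OF _ _ q, of H x] S(2)[OF that(1)] that(2) \<open>q = 3\<close> by simp
  \<comment> \<open>Four conjugates meeting pairwise only in the identity contribute two elements of
    order 3 each, so \<open>U\<close> has eight elements.\<close>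
  define U where "U = (\<Union>H\<in>S. H - {\<one>})"
  have "card U = (\<Sum>H\<in>S. card (H - {\<one>}))"
    unfolding U_def
  proof (rule card_UN_disjoint[OF S(1)])
    show "\<forall>H\<in>S. finite (H - {\<one>})"
      using S(2) finite_subset[OF subgroup.subset fin] by simp
    show "\<forall>H\<in>S. \<forall>H'\<in>S. H \<noteq> H' \<longrightarrow> (H - {\<one>}) \<inter> (H' - {\<one>}) = {}"
    proof (intro ballI impI)
      fix H H' assume H: "H \<in> S" "H' \<in> S" "H \<noteq> H'"
      have "x = \<one>" if "x \<in> H" "x \<in> H'" for x
        using prime_subgroups_eq_if_common_element[OF fin q, of H H' x] S(2)[OF H(1)] S(2)[OF H(2)] H(3) that
        by blast
      then show "(H - {\<one>}) \<inter> (H' - {\<one>}) = {}" by blast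
    qed
  qed
  also have "\<dots> = (\<Sum>H\<in>S. 2)"
  proof (rule sum.cong[OF refl])
    fix H assume "H \<in> S"
    then have H: "subgroup H G" "card H = 3" using S(2) \<open>q = 3\<close> by simp_all
    have "finite H" by (rule finite_subset[OF subgroup.subset[OF H(1)] fin])
    then show "card (H - {\<one>}) = 2"
      using H subgroup.one_closed[OF H(1)] by (simp add: card_Diff_singleton)
  qed
  finally have cardU: "card U = 8" using cardS \<open>p = 2\<close> by simp
  have UG: "U \<subseteq> carrier G"
  proof
    fix x assume "x \<in> U"
    then obtain H where "H \<in> S" "x \<in> H" by (auto simp: U_def)
    then show "x \<in> carrier G" using S(2) subgroup.mem_carrier by fast
  qed
  have ordU: "ord x = 3" if "x \<in> U" for x using that ordx by (auto simp: U_def)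
  have "P \<inter> U = {}"
  proof (rule ccontr)
    assume "P \<inter> U \<noteq> {}"
    then obtain x where x: "x \<in> P" "x \<in> U" by blast
    then have "3 dvd (4::nat)"
      using ord_dvd_card_subgroup[OF P(1) x(1)] ordU P(2) \<open>p = 2\<close> by simp
    then show False by presburger
  qed
  \<comment> \<open>Both sides have four elements, so the inclusion is an equality.\<close>
  then have "P \<subseteq> carrier G - U" using subgroup.subset[OF P(1)] by blast
  moreover have "card (carrier G - U) = card P"
    using card_Diff_subset[OF finite_subset[OF UG fin] UG] cardU ord P(2) \<open>p = 2\<close> \<open>q = 3\<close>
    by (simp add: order_def)
  ultimately have PU: "P = carrier G - U" using fin by (intro card_subset_eq) auto
  have "cyclic_weight G (carrier G) = cyclic_weight G (carrier G - U) + cyclic_weight G U"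
    unfolding cyclic_weight_def by (rule sum.subset_diff[OF UG fin])
  moreover have "cyclic_weight G U = (\<Sum>x\<in>U. 1 / 2)"
    unfolding cyclic_weight_def
  proof (rule sum.cong[OF refl])
    fix x assume "x \<in> U"
    moreover have "totient 3 = 2" using totient_prime[of 3] q \<open>q = 3\<close> by simp
    ultimately show "1 / real (totient (ord x)) = 1 / 2" using ordU by simp
  qed
  ultimately show "cyclic_weight G (carrier G) = cyclic_weight G P + 4"
    using cardU PU by simp
qed

end

section \<open>The two cases combined\<close>

theorem proposition3p3:
  fixes G :: "('a, 'b) monoid_scheme" and p q :: nat
  assumes "group G" and "finite (carrier G)"
    and "Factorial_Ring.prime p" and "Factorial_Ring.prime q" and "p < q"
    and "Coset.order G = p ^ 2 * q"
  shows "card (cyclic_subgroups G) \<in> {6, 2 * p + 4, p * q + 4, q + 4, 2 * q + 2}"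
proof -
  interpret group G by fact
  have fin: "finite (carrier G)" by fact
  have cop: "coprime (p\<^sup>2) q" using assms(3-5) by (simp add: primes_coprime)
  obtain P where P: "subgroup P G" "card P = p\<^sup>2"
    using sylow_thm[OF assms(3,1,6,2)] by blast
  obtain Q where Q: "subgroup Q G" "card Q = q"
    using sylow_thm[OF assms(4,1) _ assms(2), of 1 "p\<^sup>2"] assms(6) by (auto simp: mult.commute)
  have "cyclic_weight G (carrier G) \<in> real ` {6, 2 * p + 4, p * q + 4, q + 4, 2 * q + 2}"
  proof (cases "Q \<lhd> G")
    case True
    interpret normal_prime_complement G Q P q
      using True fin Q(2) assms(4,6) P cop
      by (intro normal_prime_complement.intro normal_prime_complement_axioms.intro is_group) simp_all
    show ?thesis by (rule cyclic_weight_cases[OF P(2) assms(3)])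
  next
    case False
    note nn = cyclic_weight_sylow_not_normal[OF fin assms(3-6) P Q False]
    \<comment> \<open>With \<open>p = 2\<close> and \<open>q = 3\<close> the weight is
      \<open>3 + 4 = q + 4\<close> or \<open>4 + 4 = 2 * p + 4\<close>. Both values are in the list,
      so cyclic \<open>P\<close> need not be excluded.\<close>
    show ?thesis
      using cyclic_weight_prime_square_order[OF fin P assms(3)] nn(3) unfolding nn(1,2) by auto
  qed
  then show ?thesis
    unfolding card_cyclic_subgroups[OF fin, symmetric] by (simp only: inj_image_mem_iff[OF inj_of_nat])
qed

end
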